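(* Let $A$ be a point-fibred attractor of an iterated function system $\mathcal{F}=\{\mathbb{X};\,f_1,\dots,f_N\}$ on a complete metric space $\mathbb{X}$. For the f-manifold of $(\mathcal{F},A)$ there are at most $N+1$ topologically distinct (pairwise non-homeomorphic) leaves. Specifically, the leaf $l(\varnothing)$ is homeomorphic to $A$, and the leaf $l(\theta)$ for $\theta\neq\varnothing$ is homeomorphic to $A\setminus f_{i_\theta}(A)$, where $-i_\theta$ is the last component of $\theta$.
   Context: An iterated function system (IFS) $\mathcal{F}=\{\mathbb{X};\,f_1,\dots,f_N\}$ is a complete metric space $(\mathbb{X},d_{\mathbb{X}})$ together with finitely many homeomorphisms $f_n:\mathbb{X}\to\mathbb{X}$ of $\mathbb{X}$ onto itself. $H$ is the set of nonempty compact subsets of $\mathbb{X}$ with the Hausdorff metric. For $S\subset\mathbb{X}$, $F(S)=\bigcup_{n=1}^N f_n(S)$, and $F^k$ is the $k$-fold iterate of $F$. An attractor of $\mathcal{F}$ is a set $A\in H$ with $F(A)=A$ for which there is an open set $U\supset A$ such that $F^k(C)\to A$ in the Hausdorff metric for every $C\in H$ with $C\subset U$. The union of all such open sets $U$ is the basin $B(A)$ of $A$. $I_+=\{1,\dots,N\}$, $I_-=\{-1,\dots,-N\}$, $I=I_+\cup I_-$; $\mathbb{I}_+=I_+^\infty$, $\mathbb{I}=\{\iota\in I^\infty:\iota_i\neq-\iota_{i+1}\text{ for all } i\}$ (infinite words indexed by $\mathbb{N}=\{1,2,\dots\}$). $S$ is the shift $S(\iota_1\iota_2\cdots)=\iota_2\iota_3\cdots$;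 $\iota|k=\iota_1\cdots\iota_k$ ($\iota|0=\varnothing$, the empty word). Let $$\widehat{\mathbb{I}}=\{\iota\in\mathbb{I}:\exists k\in\mathbb{N},\ \iota_j\in I_-\text{ for }j<k,\ \iota_j\in I_+\text{ for }j\geq k\}.$$ Set $f_{-n}=f_n^{-1}$ for $n\in I_+$ and $f_{\iota|k}=f_{\iota_1}\circ\cdots\circ f_{\iota_k}$. $A$ is point-fibred if for every $\iota\in\mathbb{I}_+$ the limit $\lim_{k\to\infty}f_{\iota|k}(C)$ exists in the Hausdorff metric for all $C\in H$ with $C\subset B(A)$, is a singleton subset of $A$, and is independent of $C$. The extended coding map $\pi:\widehat{\mathbb{I}}\to\mathbb{X}$ is $\pi(\iota)=\lim_{k\to\infty}f_{\iota|k}(b)$, which exists and is independent of $b\in B(A)$. Branched fractal manifold. For $\iota\in\widehat{\mathbb{I}}$ let $k_\iota=\min\{k\geq 0:\pi(S^k(\iota))\in A\}$ and $[\iota]=\iota|k_\iota$ (a finite, possibly empty, word). Define $\iota\sim\omega$ on $\widehat{\mathbb{I}}$ iff $[\iota]=[\omega]$ and $\pi(\iota)=\pi(\omega)$. Let $\mathbb{L}=\widehat{\mathbb{I}}/{\sim}$, with $\widetilde{\iota}$ the class of $\iota$; define $\widehat{\pi}:\mathbb{L}\to\mathbb{X}$ by $\widehat{\pi}(\widetilde{\iota})=\pi(\iota)$, and $[\alpha]=[\iota]$ for $\alpha=\widetilde{\iota}$. For a finite (possibly empty) word $\theta=\theta_1\cdots\theta_m$ in the alphabet $I_-$, the leaf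 is $l(\theta)=\{\alpha\in\mathbb{L}:[\alpha]=\theta\}$ and the panicle is $p(\theta)=l(\varnothing)\cup l(\theta_1)\cup l(\theta_1\theta_2)\cup\cdots\cup l(\theta)$. For $\alpha,\beta\in\mathbb{L}$, let $[\alpha,\beta]$ be the longest common prefix of $[\alpha]$ and $[\beta]$, and $p(\alpha,\beta)=p([\alpha,\beta])$. The metric on $\mathbb{L}$ is $$d_{\mathbb{L}}(\alpha,\beta)=\min\{d_{\mathbb{X}}(\widehat{\pi}(\alpha),\widehat{\pi}(\iota))+d_{\mathbb{X}}(\widehat{\pi}(\iota),\widehat{\pi}(\beta)):\iota\in p(\alpha,\beta)\}.$$ $(\mathbb{L},d_{\mathbb{L}})$ is the f-manifold (branched fractal manifold) generated by $(\mathcal{F},A)$; leaves carry the subspace topology. *)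

theory Defs
  imports "HOL-Analysis.Analysis" "HOL-Library.Stream" "HOL-Library.Sublist"
begin

definition ifs :: "nat \<Rightarrow> (nat \<Rightarrow> 'a::complete_space \<Rightarrow> 'a) \<Rightarrow> bool" where
  "ifs N f \<longleftrightarrow> (\<forall>n\<in>{1..N}. \<exists>g. homeomorphism UNIV UNIV (f n) g)"

definition hutch :: "nat \<Rightarrow> (nat \<Rightarrow> 'a \<Rightarrow> 'a) \<Rightarrow> 'a set \<Rightarrow> 'a set" where
  "hutch N f S = (\<Union>n\<in>{1..N}. f n ` S)"

definition ne_compacts :: "'a::metric_space set set" where
  "ne_compacts = {C. C \<noteq> {} \<and> compact C}"

text \<open>Only meaningful (and only used) on nonempty compact sets.\<close>

definition hausdorff_dist :: "'a::metric_space set \<Rightarrow> 'a set \<Rightarrow> real" where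
  "hausdorff_dist S T = max (SUP x\<in>S. infdist x T) (SUP y\<in>T. infdist y S)"

definition hausdorff_tendsto :: "(nat \<Rightarrow> 'a::metric_space set) \<Rightarrow> 'a set \<Rightarrow> bool" where
  "hausdorff_tendsto K L \<longleftrightarrow> (\<lambda>k. hausdorff_dist (K k) L) \<longlonglongrightarrow> 0"

definition attracting_nbhd ::
    "nat \<Rightarrow> (nat \<Rightarrow> 'a::complete_space \<Rightarrow> 'a) \<Rightarrow> 'a set \<Rightarrow> 'a set \<Rightarrow> bool" where
  "attracting_nbhd N f A U \<longleftrightarrow> open U \<and> A \<subseteq> U \<and>
     (\<forall>C\<in>ne_compacts. C \<subseteq> U \<longrightarrow> hausdorff_tendsto (\<lambda>k. (hutch N f ^^ k) C) A)"

definition attractor :: "nat \<Rightarrow> (nat \<Rightarrow> 'a::complete_space \<Rightarrow> 'a) \<Rightarrow> 'a set \<Rightarrow> bool" where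
  "attractor N f A \<longleftrightarrow> A \<in> ne_compacts \<and> hutch N f A = A \<and> (\<exists>U. attracting_nbhd N f A U)"

definition basin :: "nat \<Rightarrow> (nat \<Rightarrow> 'a::complete_space \<Rightarrow> 'a) \<Rightarrow> 'a set \<Rightarrow> 'a set" where
  "basin N f A = \<Union>{U. attracting_nbhd N f A U}"

text \<open>Letters are integers.  Infinite words are streams: the entry \<open>\<iota> !! i\<close> is the letter
  with index \<open>i + 1\<close> when letters are numbered from 1, \<open>sdrop k\<close> is the \<open>k\<close>-fold shift, and
  \<open>stake k \<iota>\<close> is the prefix of length \<open>k\<close>.\<close>

definition pos_letters :: "nat \<Rightarrow> int set" where
  "pos_letters N = {1..int N}"

definition neg_letters :: "nat \<Rightarrow> int set" where
  "neg_letters N = uminus ` pos_letters N"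

definition reduced_words :: "nat \<Rightarrow> int stream set" where
  "reduced_words N = {\<iota> \<in> streams (pos_letters N \<union> neg_letters N). \<forall>i. \<iota> !! i \<noteq> - (\<iota> !! Suc i)}"

definition hat_words :: "nat \<Rightarrow> int stream set" where
  "hat_words N = {\<iota> \<in> reduced_words N.
     \<exists>k. (\<forall>j<k. \<iota> !! j \<in> neg_letters N) \<and> (\<forall>j\<ge>k. \<iota> !! j \<in> pos_letters N)}"

definition letter_map :: "(nat \<Rightarrow> 'a \<Rightarrow> 'a) \<Rightarrow> int \<Rightarrow> 'a \<Rightarrow> 'a" where
  "letter_map f i = (if 0 < i then f (nat i) else inv (f (nat (- i))))"

definition word_map :: "(nat \<Rightarrow> 'a \<Rightarrow> 'a) \<Rightarrow> int list \<Rightarrow> 'a \<Rightarrow> 'a" where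
  "word_map f w = foldr (letter_map f) w"

definition point_fibred :: "nat \<Rightarrow> (nat \<Rightarrow> 'a::complete_space \<Rightarrow> 'a) \<Rightarrow> 'a set \<Rightarrow> bool" where
  "point_fibred N f A \<longleftrightarrow>
     (\<forall>\<iota>\<in>streams (pos_letters N). \<exists>x\<in>A. \<forall>C\<in>ne_compacts. C \<subseteq> basin N f A \<longrightarrow>
        hausdorff_tendsto (\<lambda>k. word_map f (stake k \<iota>) ` C) {x})"

definition coding :: "nat \<Rightarrow> (nat \<Rightarrow> 'a::complete_space \<Rightarrow> 'a) \<Rightarrow> 'a set \<Rightarrow> int stream \<Rightarrow> 'a" where
  "coding N f A \<iota> = (THE x. \<forall>b\<in>basin N f A. (\<lambda>k. word_map f (stake k \<iota>) b) \<longlonglongrightarrow> x)"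

definition entry_time ::
    "nat \<Rightarrow> (nat \<Rightarrow> 'a::complete_space \<Rightarrow> 'a) \<Rightarrow> 'a set \<Rightarrow> int stream \<Rightarrow> nat" where
  "entry_time N f A \<iota> = (LEAST k. coding N f A (sdrop k \<iota>) \<in> A)"

definition address ::
    "nat \<Rightarrow> (nat \<Rightarrow> 'a::complete_space \<Rightarrow> 'a) \<Rightarrow> 'a set \<Rightarrow> int stream \<Rightarrow> int list" where
  "address N f A \<iota> = stake (entry_time N f A \<iota>) \<iota>"

definition fm_rel ::
    "nat \<Rightarrow> (nat \<Rightarrow> 'a::complete_space \<Rightarrow> 'a) \<Rightarrow> 'a set \<Rightarrow> (int stream \<times> int stream) set" where
  "fm_rel N f A = {(\<iota>, \<omega>). \<iota> \<in> hat_words N \<and> \<omega> \<in> hat_words N \<and>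
     address N f A \<iota> = address N f A \<omega> \<and> coding N f A \<iota> = coding N f A \<omega>}"

definition fmanifold ::
    "nat \<Rightarrow> (nat \<Rightarrow> 'a::complete_space \<Rightarrow> 'a) \<Rightarrow> 'a set \<Rightarrow> int stream set set" where
  "fmanifold N f A = hat_words N // fm_rel N f A"

text \<open>The coding map and the address are constant on each class, so their images of a class are
  singletons.\<close>

definition fm_proj ::
    "nat \<Rightarrow> (nat \<Rightarrow> 'a::complete_space \<Rightarrow> 'a) \<Rightarrow> 'a set \<Rightarrow> int stream set \<Rightarrow> 'a" where
  "fm_proj N f A \<alpha> = the_elem (coding N f A ` \<alpha>)"

definition fm_address ::
    "nat \<Rightarrow> (nat \<Rightarrow> 'a::complete_space \<Rightarrow> 'a) \<Rightarrow> 'a set \<Rightarrow> int stream set \<Rightarrow> int list" where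
  "fm_address N f A \<alpha> = the_elem (address N f A ` \<alpha>)"

definition leaf ::
    "nat \<Rightarrow> (nat \<Rightarrow> 'a::complete_space \<Rightarrow> 'a) \<Rightarrow> 'a set \<Rightarrow> int list \<Rightarrow> int stream set set" where
  "leaf N f A \<theta> = {\<alpha> \<in> fmanifold N f A. fm_address N f A \<alpha> = \<theta>}"

definition panicle ::
    "nat \<Rightarrow> (nat \<Rightarrow> 'a::complete_space \<Rightarrow> 'a) \<Rightarrow> 'a set \<Rightarrow> int list \<Rightarrow> int stream set set" where
  "panicle N f A \<theta> = (\<Union>k\<le>length \<theta>. leaf N f A (take k \<theta>))"

text \<open>The infimum is a minimum: the projection of a panicle is a finite union of homeomorphic
  images of \<open>A\<close>, hence compact.\<close>

definition fm_dist ::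
    "nat \<Rightarrow> (nat \<Rightarrow> 'a::complete_space \<Rightarrow> 'a) \<Rightarrow> 'a set \<Rightarrow>
     int stream set \<Rightarrow> int stream set \<Rightarrow> real" where
  "fm_dist N f A \<alpha> \<beta> =
     (INF \<kappa>\<in>panicle N f A (longest_common_prefix (fm_address N f A \<alpha>) (fm_address N f A \<beta>)).
        dist (fm_proj N f A \<alpha>) (fm_proj N f A \<kappa>) + dist (fm_proj N f A \<kappa>) (fm_proj N f A \<beta>))"

definition fm_topology ::
    "nat \<Rightarrow> (nat \<Rightarrow> 'a::complete_space \<Rightarrow> 'a) \<Rightarrow> 'a set \<Rightarrow> int stream set topology" where
  "fm_topology N f A = Metric_space.mtopology (fmanifold N f A) (fm_dist N f A)"

definition leaves ::
    "nat \<Rightarrow> (nat \<Rightarrow> 'a::complete_space \<Rightarrow> 'a) \<Rightarrow> 'a set \<Rightarrow> int stream set set set" where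
  "leaves N f A = leaf N f A ` lists (neg_letters N)"

end

theory Submission
  imports Defs
begin

text \<open>
  Since \<open>f\<^sub>i(A) \<subseteq> A\<close>, applying an inverse map can leave \<open>A\<close> but never re-enter it.  Hence a word
  with address \<open>\<theta>\<close> codes a point \<open>f\<^sub>\<theta>(a)\<close> where \<open>a \<in> A\<close> and, for \<open>\<theta> \<noteq> []\<close>, \<open>a \<notin> f\<^sub>i(A)\<close> with \<open>- i\<close> the
  last letter of \<open>\<theta>\<close>; conversely such an \<open>a\<close> has a positive address, which cannot start with \<open>i\<close>, so
  prefixing \<open>\<theta>\<close> keeps the word reduced.  The projection therefore maps the leaf of \<open>\<theta>\<close> bijectively
  onto \<open>f\<^sub>\<theta>(A - f\<^sub>i(A))\<close>.

  The sets \<open>f\<^sub>\<theta>(A)\<close> increase along prefixes, so the pieces \<open>f\<^sub>\<theta>(A - f\<^sub>i(A))\<close> telescope and the panicle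
  of \<open>\<theta>\<close> projects injectively onto the compact set \<open>f\<^sub>\<theta>(A)\<close>.  This makes the infimum distance definite,
  and the ultrametric behaviour of common prefixes gives the triangle inequality.  Two points of one
  leaf lie in their own panicle, so on a leaf the distance is that of the projections: the
  projection is an isometry, and \<open>f\<^sub>\<theta>\<close> is a homeomorphism of the space.
\<close>

section \<open>Homeomorphisms, the Hausdorff distance and word maps\<close>

lemma homeomorphism_inv_cancel:
  assumes "homeomorphism UNIV UNIV h g"
  shows "inv h (h x) = x" and "h (inv h x) = x"
proof -
  have "inj h" and "surj h"
    using assms by (auto simp: homeomorphism_def intro: inj_on_inverseI)
  then show "inv h (h x) = x" and "h (inv h x) = x"
    by (simp_all add: surj_f_inv_f)
qed

lemma homeomorphism_inv:
  assumes "homeomorphism UNIV UNIV h g"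
  shows "homeomorphism UNIV UNIV (inv h) h"
proof -
  have "inv h = g"
    using assms by (intro inv_unique_comp) (auto simp: homeomorphism_def)
  then show ?thesis
    using assms homeomorphism_symD by blast
qed

lemma hausdorff_dist_singletons [simp]: "hausdorff_dist {x} {y} = dist x y"
  by (simp add: hausdorff_dist_def dist_commute)

text \<open>Compactness bounds the distances from points of \<open>K\<close> to \<open>x\<close>, so
  the supremum in \<open>hausdorff_dist\<close> really dominates each of them.\<close>

lemma dist_le_hausdorff_dist_singleton:
  fixes K :: "'a::metric_space set"
  assumes "compact K" and "a \<in> K"
  shows "dist a x \<le> hausdorff_dist K {x}"
proof -
  have "bdd_above ((\<lambda>y. infdist y {x}) ` K)"
    by (intro bounded_imp_bdd_above compact_imp_bounded compact_continuous_image
        continuous_intros assms)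
  then have "infdist a {x} \<le> (SUP y\<in>K. infdist y {x})"
    by (intro cSUP_upper assms)
  then show ?thesis
    by (simp add: hausdorff_dist_def)
qed

lemma word_map_Nil [simp]: "word_map f [] = id"
  and word_map_Cons: "word_map f (i # w) = letter_map f i \<circ> word_map f w"
  and word_map_append: "word_map f (u @ w) = word_map f u \<circ> word_map f w"
  by (auto simp: word_map_def)

section \<open>Shortest detours through a set\<close>

text \<open>Length of a shortest route from \<open>x\<close> to \<open>y\<close> that must visit
  \<open>K\<close>. With \<open>K\<close> the projection of a panicle this becomes the distance of
  the f-manifold.\<close>

definition detour_dist :: "'a::metric_space set \<Rightarrow> 'a \<Rightarrow> 'a \<Rightarrow> real" where
  "detour_dist K x y = (INF k\<in>K. dist x k + dist k y)"

lemma detour_dist_le: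
  assumes "k \<in> K"
  shows "detour_dist K x y \<le> dist x k + dist k y"
  unfolding detour_dist_def
  by (rule cINF_lower[OF _ assms]) (auto intro!: bdd_belowI2[where m = 0])

lemma detour_dist_ge:
  assumes "K \<noteq> {}"
  shows "dist x y \<le> detour_dist K x y"
  unfolding detour_dist_def by (rule cINF_greatest[OF assms]) (rule dist_triangle)

lemma detour_dist_through:
  assumes "x \<in> K"
  shows "detour_dist K x y = dist x y"
  using detour_dist_le[OF assms, of x y] detour_dist_ge[of K x y] assms by fastforce

lemma detour_dist_commute: "detour_dist K x y = detour_dist K y x"
  by (simp add: detour_dist_def dist_commute add.commute)

lemma detour_dist_attained:
  assumes "compact K" and "K \<noteq> {}"
  obtains k where "k \<in> K" and "detour_dist K x y = dist x k + dist k y"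
proof -
  obtain k where k: "k \<in> K" "\<forall>k'\<in>K. dist x k + dist k y \<le> dist x k' + dist k' y"
    using continuous_attains_inf[OF assms, of "\<lambda>k. dist x k + dist k y"]
    by (force intro: continuous_intros)
  then have "dist x k + dist k y \<le> detour_dist K x y"
    unfolding detour_dist_def by (intro cINF_greatest assms) auto
  with k(1) detour_dist_le[OF k(1), of x y] that show ?thesis
    by force
qed

text \<open>A best stop \<open>k\<close> between \<open>x\<close> and \<open>y\<close> also lies in
  \<open>J\<close>, so it serves for the route from \<open>x\<close> to \<open>z\<close>; the second
  leg is only compared with the straight distance from \<open>y\<close> to \<open>z\<close>.\<close>

lemma detour_dist_triangle:
  assumes "compact K" and "K \<noteq> {}" and "compact L" and "L \<noteq> {}" and "K \<subseteq> J"
  shows "detour_dist J x z \<le> detour_dist K x y + detour_dist L y z"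
proof -
  obtain k where k: "k \<in> K" "detour_dist K x y = dist x k + dist k y"
    using detour_dist_attained[OF assms(1,2)] .
  have "detour_dist J x z \<le> dist x k + dist k z"
    using k(1) assms(5) by (intro detour_dist_le) auto
  also have "\<dots> \<le> (dist x k + dist k y) + dist y z"
    using dist_triangle[of k z y] by simp
  also have "\<dots> \<le> detour_dist K x y + detour_dist L y z"
    using k(2) detour_dist_ge[OF assms(4), of y z] by simp
  finally show ?thesis .
qed

section \<open>Longest common prefixes\<close>

lemma longest_common_prefix_commute: "longest_common_prefix xs ys = longest_common_prefix ys xs"
  by (meson longest_common_prefix_max_prefix longest_common_prefix_prefix1
      longest_common_prefix_prefix2 prefix_order.antisym)

lemma longest_common_prefix_self: "longest_common_prefix xs xs = xs"
  by (simp add: longest_common_prefix_max_prefix longest_common_prefix_prefix1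
      prefix_order.antisym)

text \<open>Both prefixes on the left are prefixes of \<open>ys\<close>, hence comparable; the
  shorter one is a prefix of all three lists.\<close>

lemma longest_common_prefix_ultrametric:
  "prefix (longest_common_prefix xs ys) (longest_common_prefix xs zs)
   \<or> prefix (longest_common_prefix ys zs) (longest_common_prefix xs zs)"
proof -
  have "prefix (longest_common_prefix xs ys) (longest_common_prefix ys zs)
      \<or> prefix (longest_common_prefix ys zs) (longest_common_prefix xs ys)"
    using longest_common_prefix_prefix1 longest_common_prefix_prefix2 prefix_same_cases by blast
  then show ?thesis
    by (meson longest_common_prefix_max_prefix longest_common_prefix_prefix1
        longest_common_prefix_prefix2 prefix_order.trans)
qed

section \<open>Isometries and homeomorphic subspaces\<close>

lemma (in Metric_space) isometric_subset_homeomorphic: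
  fixes p :: "'a \<Rightarrow> 'b::metric_space"
  assumes "S \<subseteq> M" and iso: "\<And>x y. \<lbrakk>x \<in> S; y \<in> S\<rbrakk> \<Longrightarrow> d x y = dist (p x) (p y)"
  shows "subtopology mtopology S homeomorphic_space top_of_set (p ` S)"
proof -
  interpret S: Submetric M d S
    by unfold_locales fact
  interpret P: Submetric UNIV dist "p ` S"
    by unfold_locales simp
  have inj: "inj_on p S"
    by (metis iso dist_self inj_onI S.sub.zero)
  have "continuous_map S.sub.mtopology P.sub.mtopology p"
    unfolding S.sub.metric_continuous_map[OF P.sub.Metric_space_axioms]
    using iso by auto
  moreover have "continuous_map P.sub.mtopology S.sub.mtopology (inv_into S p)"
    unfolding P.sub.metric_continuous_map[OF S.sub.Metric_space_axioms]
    using iso inj by auto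
  ultimately have "homeomorphic_maps S.sub.mtopology P.sub.mtopology p (inv_into S p)"
    using inj by (auto simp: homeomorphic_maps_def f_inv_into_f)
  then have "S.sub.mtopology homeomorphic_space P.sub.mtopology"
    by (rule homeomorphic_maps_imp_homeomorphic_space)
  then show ?thesis
    by (simp add: S.mtopology_submetric P.mtopology_submetric)
qed

lemma homeomorphism_imp_homeomorphic_space:
  assumes "homeomorphism S T h g"
  shows "top_of_set S homeomorphic_space top_of_set T"
  using assms unfolding homeomorphic_space_def homeomorphic_maps_def homeomorphism_def
  by (intro exI[of _ h] exI[of _ g]) auto

section \<open>Letter maps, word maps and the attractor\<close>

locale point_fibred_ifs =
  fixes N :: nat and f :: "nat \<Rightarrow> 'a::complete_space \<Rightarrow> 'a" and A :: "'a set"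
  assumes ifs: "ifs N f" and attractor: "attractor N f A" and point_fibred: "point_fibred N f A"
begin

abbreviation letters :: "int set" where
  "letters \<equiv> pos_letters N \<union> neg_letters N"

abbreviation letter :: "int \<Rightarrow> 'a \<Rightarrow> 'a" where
  "letter \<equiv> letter_map f"

abbreviation word :: "int list \<Rightarrow> 'a \<Rightarrow> 'a" where
  "word \<equiv> word_map f"

abbreviation code :: "int stream \<Rightarrow> 'a" where
  "code \<equiv> coding N f A"

lemma neg_letters_iff: "i \<in> neg_letters N \<longleftrightarrow> - i \<in> pos_letters N"
  unfolding neg_letters_def by (metis imageE image_eqI minus_minus)

lemma homeomorphism_letter:
  assumes "i \<in> letters"
  obtains g where "homeomorphism UNIV UNIV (letter i) g"
proof (cases "0 < i")
  case True
  then have "nat i \<in> {1..N}"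
    using assms unfolding neg_letters_iff Un_iff pos_letters_def by auto
  with True that ifs show ?thesis
    unfolding ifs_def letter_map_def by (metis (full_types))
next
  case False
  then have "nat (- i) \<in> {1..N}"
    using assms unfolding neg_letters_iff Un_iff pos_letters_def by auto
  then obtain g where "homeomorphism UNIV UNIV (f (nat (- i))) g"
    using ifs unfolding ifs_def by blast
  with False that homeomorphism_inv show ?thesis
    unfolding letter_map_def by (metis (full_types))
qed

lemma letter_cancel [simp]:
  assumes "i \<in> neg_letters N"
  shows "letter i (letter (- i) x) = x" and "letter (- i) (letter i x) = x"
proof -
  have i: "i < 0" and "nat (- i) \<in> {1..N}"
    using assms unfolding neg_letters_iff pos_letters_def by auto
  then obtain g where "homeomorphism UNIV UNIV (f (nat (- i))) g"
    using ifs unfolding ifs_def by blast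
  with i show "letter i (letter (- i) x) = x" and "letter (- i) (letter i x) = x"
    by (simp_all add: letter_map_def homeomorphism_inv_cancel)
qed

lemma homeomorphism_word:
  assumes "w \<in> lists letters"
  obtains g where "homeomorphism UNIV UNIV (word w) g"
  using assms
proof (induction w arbitrary: thesis rule: lists.induct)
  case Nil
  show ?case
    by (rule Nil[of id]) (simp add: homeomorphism_def)
next
  case (Cons i w)
  obtain g h where "homeomorphism UNIV UNIV (word w) g" "homeomorphism UNIV UNIV (letter i) h"
    using Cons.IH homeomorphism_letter[OF Cons.hyps(1)] by metis
  then show ?case
    using Cons.prems homeomorphism_compose by (metis word_map_Cons)
qed

lemma continuous_on_word: "w \<in> lists letters \<Longrightarrow> continuous_on S (word w)"
  by (metis homeomorphism_word homeomorphism_cont1 continuous_on_subset subset_UNIV)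

lemma inj_word:
  assumes "w \<in> lists letters"
  shows "inj (word w)"
proof -
  obtain g where "homeomorphism UNIV UNIV (word w) g"
    using homeomorphism_word[OF assms] .
  then show ?thesis
    by (intro inj_on_inverseI[of _ g]) (simp add: homeomorphism_def)
qed

lemma compact_A: "compact A" and A_nonempty: "A \<noteq> {}" and hutch_A: "hutch N f A = A"
  using attractor unfolding attractor_def ne_compacts_def by auto

lemma A_subset_basin: "A \<subseteq> basin N f A"
  using attractor unfolding attractor_def basin_def attracting_nbhd_def by auto

lemma A_eq_Union_letter: "A = (\<Union>i\<in>pos_letters N. letter i ` A)"
proof -
  have "pos_letters N = int ` {1..N}"
    unfolding pos_letters_def by (simp add: image_int_atLeastAtMost)
  then have "(\<Union>i\<in>pos_letters N. letter i ` A) = hutch N f A"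
    unfolding hutch_def by (simp add: letter_map_def)
  then show ?thesis
    using hutch_A by simp
qed

lemma letter_neg_mem_A:
  assumes "i \<in> neg_letters N" and "a \<in> A"
  shows "letter (- i) a \<in> A"
  using assms A_eq_Union_letter unfolding neg_letters_iff by blast

section \<open>The coding map\<close>

lemma coding_eqI:
  assumes "\<And>b. b \<in> basin N f A \<Longrightarrow> (\<lambda>k. word (stake k \<iota>) b) \<longlonglongrightarrow> x"
  shows "code \<iota> = x"
  unfolding coding_def
proof (rule the_equality)
  fix y
  assume "\<forall>b\<in>basin N f A. (\<lambda>k. word (stake k \<iota>) b) \<longlonglongrightarrow> y"
  then show "y = x"
    \<comment> \<open>The limit is determined because the basin contains \<open>A\<close> and so has
      at least one point to test.\<close>
    using A_nonempty A_subset_basin assms LIMSEQ_unique by blast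
qed (use assms in blast)

text \<open>Point-fibredness is used for two kinds of compact sets: \<open>C = {b}\<close> gives
  pointwise convergence, and \<open>C = A\<close> gives the shrinking of the images of
  \<open>A\<close>.\<close>

lemma coding_pos:
  assumes "\<omega> \<in> streams (pos_letters N)"
  shows coding_pos_mem: "code \<omega> \<in> A"
    and coding_pos_tendsto: "b \<in> basin N f A \<Longrightarrow> (\<lambda>k. word (stake k \<omega>) b) \<longlonglongrightarrow> code \<omega>"
    and coding_pos_hausdorff: "hausdorff_tendsto (\<lambda>k. word (stake k \<omega>) ` A) {code \<omega>}"
proof -
  obtain x where x: "x \<in> A" and
    lim: "\<And>C. C \<in> ne_compacts \<Longrightarrow> C \<subseteq> basin N f A
           \<Longrightarrow> hausdorff_tendsto (\<lambda>k. word (stake k \<omega>) ` C) {x}"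
    using point_fibred assms unfolding point_fibred_def by blast
  have pt: "(\<lambda>k. word (stake k \<omega>) b) \<longlonglongrightarrow> x" if "b \<in> basin N f A" for b
    using lim[of "{b}"] that unfolding tendsto_dist_iff[of _ x]
    by (simp add: hausdorff_tendsto_def ne_compacts_def)
  have eq: "code \<omega> = x"
    using pt by (rule coding_eqI)
  show "code \<omega> \<in> A" "b \<in> basin N f A \<Longrightarrow> (\<lambda>k. word (stake k \<omega>) b) \<longlonglongrightarrow> code \<omega>"
    "hausdorff_tendsto (\<lambda>k. word (stake k \<omega>) ` A) {code \<omega>}"
    using eq x pt lim A_subset_basin compact_A A_nonempty by (auto simp: ne_compacts_def)
qed

lemma stake_in_lists:
  assumes "\<iota> \<in> streams B"
  shows "stake k \<iota> \<in> lists B"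
  using assms by (induction k arbitrary: \<iota>) (auto simp: streams_shd streams_stl)

text \<open>Once the prefix \<open>w\<close> has been read, its continuous map can be pulled out of
  the limit. Codes of words with negative letters are thus reduced to codes of positive
  words.\<close>

lemma coding_shift_pos:
  assumes "w \<in> lists letters" and "\<omega> \<in> streams (pos_letters N)"
  shows "code (w @- \<omega>) = word w (code \<omega>)"
proof (rule coding_eqI)
  fix b
  assume b: "b \<in> basin N f A"
  have "(\<lambda>k. word w (word (stake k \<omega>) b)) \<longlonglongrightarrow> word w (code \<omega>)"
    using coding_pos_tendsto[OF assms(2) b] continuous_on_word[OF assms(1), of UNIV]
    by (auto intro: continuous_on_tendsto_compose)
  then have "(\<lambda>k. word (stake (k + length w) (w @- \<omega>)) b) \<longlonglongrightarrow> word w (code \<omega>)"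
    by (simp add: stake_shift word_map_append)
  then show "(\<lambda>k. word (stake k (w @- \<omega>)) b) \<longlonglongrightarrow> word w (code \<omega>)"
    by (rule LIMSEQ_offset)
qed

text \<open>Choosing preimages in \<open>A\<close> again and again yields letters for which
  \<open>a\<close> lies in all the images of \<open>A\<close> under the prefixes, and these shrink
  to the code. The last conclusion ties the first letter to \<open>a\<close>; it later keeps
  prefixed words reduced.\<close>

lemma A_has_pos_address:
  assumes "a \<in> A"
  obtains \<omega> where "\<omega> \<in> streams (pos_letters N)" and "code \<omega> = a" and "a \<in> letter (shd \<omega>) ` A"
proof -
  have "\<exists>i y. i \<in> pos_letters N \<and> y \<in> A \<and> x = letter i y" if "x \<in> A" for x
    using that A_eq_Union_letter by blast
  \<comment> \<open>\<open>p x\<close> is a chosen preimage of \<open>x\<close> in \<open>A\<close>,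
    and \<open>i x\<close> the letter whose map leads back to \<open>x\<close>.\<close>
  then obtain i p where
    ip: "\<And>x. x \<in> A \<Longrightarrow> i x \<in> pos_letters N \<and> p x \<in> A \<and> x = letter (i x) (p x)"
    by metis
  define \<omega> where "\<omega> = smap i (siterate p a)"
  have orbit: "(p ^^ k) a \<in> A" for k
    by (induction k) (use assms ip in auto)
  have \<omega>: "\<omega> \<in> streams (pos_letters N)"
    using ip orbit by (simp add: \<omega>_def streams_iff_snth)
  have tail: "word (stake k \<omega>) ((p ^^ k) a) = a" for k
  proof (induction k)
    case (Suc k)
    have "word (stake (Suc k) \<omega>) ((p ^^ Suc k) a)
        = word (stake k \<omega>) (letter (i ((p ^^ k) a)) (p ((p ^^ k) a)))"
      by (simp add: stake_Suc word_map_append word_map_Cons \<omega>_def del: stake.simps)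
    also have "\<dots> = a"
      using ip[OF orbit] Suc by simp
    finally show ?case .
  qed simp
  have "dist a (code \<omega>) \<le> hausdorff_dist (word (stake k \<omega>) ` A) {code \<omega>}" for k
  proof (rule dist_le_hausdorff_dist_singleton)
    have "stake k \<omega> \<in> lists letters"
      using stake_in_lists[OF \<omega>] lists_mono[of "pos_letters N" letters] by blast
    then show "compact (word (stake k \<omega>) ` A)"
      by (intro compact_continuous_image continuous_on_word compact_A)
    show "a \<in> word (stake k \<omega>) ` A"
      using tail orbit by (metis image_eqI)
  qed
  then have "dist a (code \<omega>) \<le> 0"
    using coding_pos_hausdorff[OF \<omega>] unfolding hausdorff_tendsto_def
    by (intro LIMSEQ_le_const) auto
  moreover have "a \<in> letter (shd \<omega>) ` A"
    using ip[OF assms] by (metis \<omega>_def image_eqI siterate.simps(1) stream.map_sel(1))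
  ultimately show thesis
    using that \<omega> by auto
qed

section \<open>Addresses and the points they realise\<close>

lemma hat_wordsE:
  assumes "\<iota> \<in> hat_words N"
  obtains k where "stake k \<iota> \<in> lists (neg_letters N)" and "sdrop k \<iota> \<in> streams (pos_letters N)"
proof -
  obtain k where k: "\<forall>j<k. \<iota> !! j \<in> neg_letters N" "\<forall>j\<ge>k. \<iota> !! j \<in> pos_letters N"
    using assms unfolding hat_words_def by blast
  have "stake k \<iota> \<in> lists (neg_letters N)"
    using k(1) by (auto simp: in_set_conv_nth)
  moreover have "sdrop k \<iota> \<in> streams (pos_letters N)"
    using k(2) by (simp add: streams_iff_snth sdrop_snth)
  ultimately show thesis
    by (rule that)
qed

text \<open>For nonempty \<theta> these are the points of \<open>A\<close> that the inverse map of
  the last letter, the first one to act in \<open>word \<theta>\<close>, sends out of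
  \<open>A\<close>.\<close>

definition core :: "int list \<Rightarrow> 'a set" where
  "core \<theta> = (if \<theta> = [] then A else A - letter (- last \<theta>) ` A)"

lemma core_subset: "core \<theta> \<subseteq> A"
  by (auto simp: core_def)

lemma neg_words_lists_letters: "\<theta> \<in> lists (neg_letters N) \<Longrightarrow> \<theta> \<in> lists letters"
  by auto

text \<open>Minimality of the entry time says that the shift just before entry still codes a point
  outside \<open>A\<close>, which is the condition in \<open>core\<close>.\<close>

lemma address_props:
  assumes "\<iota> \<in> hat_words N"
  shows address_neg: "address N f A \<iota> \<in> lists (neg_letters N)"
    and coding_mem_core: "code \<iota> \<in> word (address N f A \<iota>) ` core (address N f A \<iota>)"
proof -
  obtain k where neg: "stake k \<iota> \<in> lists (neg_letters N)"
    and pos: "sdrop k \<iota> \<in> streams (pos_letters N)"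
    using hat_wordsE[OF assms] .
  define e where "e = entry_time N f A \<iota>"
  define \<theta> where "\<theta> = address N f A \<iota>"
  have \<theta>_eq: "\<theta> = stake e \<iota>"
    by (simp add: \<theta>_def e_def address_def)
  have "code (sdrop k \<iota>) \<in> A"
    using pos by (rule coding_pos_mem)
  \<comment> \<open>The turning point \<open>k\<close> shows that the \<open>LEAST\<close> in
    \<open>entry_time\<close> is attained, and bounds it.\<close>
  then have ek: "e \<le> k" and e: "code (sdrop e \<iota>) \<in> A"
    unfolding e_def entry_time_def by (auto intro: Least_le LeastI)
  have before: "code (sdrop j \<iota>) \<notin> A" if "j < e" for j
    using that not_less_Least unfolding e_def entry_time_def by blast
  have neg_drop: "drop j (stake k \<iota>) \<in> lists (neg_letters N)" for j
    using neg by (auto dest: in_set_dropD)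
  \<comment> \<open>Each shift up to \<open>k\<close> is a negative word followed by the positive
    tail from \<open>k\<close> on, so \<open>coding_shift_pos\<close> applies.\<close>
  have tail: "code (sdrop j \<iota>) = word (drop j (stake k \<iota>)) (code (sdrop k \<iota>))" if "j \<le> k" for j
  proof -
    have "sdrop j \<iota> = drop j (stake k \<iota>) @- sdrop k \<iota>"
      using that by (metis diff_is_0_eq' length_stake sdrop.simps(1) sdrop_shift stake_sdrop)
    then show ?thesis
      using coding_shift_pos[OF neg_words_lists_letters[OF neg_drop] pos] by simp
  qed
  have "\<theta> = take e (stake k \<iota>)"
    using ek by (simp add: \<theta>_eq take_stake min_absorb1)
  then have split: "stake k \<iota> = \<theta> @ drop e (stake k \<iota>)" and "set \<theta> \<subseteq> set (stake k \<iota>)"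
    by (simp, simp add: set_take_subset)
  then have \<theta>: "\<theta> \<in> lists (neg_letters N)"
    using neg by auto
  have code: "code \<iota> = word \<theta> (code (sdrop e \<iota>))"
    using tail[of 0] tail[OF ek] split by (simp add: word_map_append) (metis comp_apply word_map_append)
  have "code (sdrop e \<iota>) \<in> core \<theta>"
  proof (cases "\<theta> = []")
    case False
    then obtain j where j: "e = Suc j"
      using \<theta>_eq by (cases e) auto
    then have last: "last \<theta> = \<iota> !! j"
      by (simp add: \<theta>_eq stake_Suc del: stake.simps)
    have i: "\<iota> !! j \<in> neg_letters N"
      using \<theta> last False last_in_set by force
    have "drop j (stake k \<iota>) = \<iota> !! j # drop e (stake k \<iota>)"
      using ek j by (metis Cons_nth_drop_Suc Suc_le_eq length_stake stake_nth)
    \<comment> \<open>Position \<open>j\<close> is one step before entry, and its code is the code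
      at \<open>e\<close> moved by the letter at \<open>j\<close>, which is the last letter of
      \<theta>.\<close>
    then have "letter (\<iota> !! j) (code (sdrop e \<iota>)) \<notin> A"
      using before[of j] tail[of j] tail[OF ek] ek j by (simp add: word_map_Cons)
    then show ?thesis
      using e i last False by (auto simp: core_def)
  qed (use e in \<open>simp add: core_def\<close>)
  with \<theta> code show "address N f A \<iota> \<in> lists (neg_letters N)"
    "code \<iota> \<in> word (address N f A \<iota>) ` core (address N f A \<iota>)"
    by (auto simp: \<theta>_def)
qed

lemma word_neg_notin_A:
  assumes "\<theta> \<in> lists (neg_letters N)" and "a \<notin> A"
  shows "word \<theta> a \<notin> A"
  using assms
proof (induction \<theta> rule: lists.induct)
  case (Cons i \<theta>)
  then have "word \<theta> a \<notin> A"
    by simp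
  then show ?case
    using letter_neg_mem_A[OF Cons.hyps(1)] letter_cancel(2)[OF Cons.hyps(1)]
    by (metis comp_apply word_map_Cons)
qed simp

text \<open>Prefix \<theta> to a positive address of \<open>a\<close>. Two facts need the
  \<open>core\<close> condition: the word is reduced at the junction, and no shift enters
  \<open>A\<close> before \<theta> is exhausted.\<close>

lemma realise_address:
  assumes \<theta>: "\<theta> \<in> lists (neg_letters N)" and a: "a \<in> core \<theta>"
  obtains \<iota> where "\<iota> \<in> hat_words N" and "address N f A \<iota> = \<theta>" and "code \<iota> = word \<theta> a"
proof -
  obtain \<omega> where \<omega>: "\<omega> \<in> streams (pos_letters N)" "code \<omega> = a" "a \<in> letter (shd \<omega>) ` A"
    using A_has_pos_address a core_subset by blast
  define \<iota> where "\<iota> = \<theta> @- \<omega>"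
  have lo: "\<iota> !! j \<in> neg_letters N" if "j < length \<theta>" for j
    using that \<theta> by (auto simp: \<iota>_def)
  have hi: "\<iota> !! j \<in> pos_letters N" if "length \<theta> \<le> j" for j
    using that \<omega>(1) by (simp add: \<iota>_def snth_in)
  have posneg: "i \<noteq> - j" if "i \<in> pos_letters N" "j \<in> pos_letters N" for i j
    using that by (auto simp: pos_letters_def)
  have reduced: "\<iota> !! j \<noteq> - (\<iota> !! Suc j)" for j
  proof (cases "Suc j" "length \<theta>" rule: linorder_cases)
    case less
    then show ?thesis
      using posneg lo[of j] lo[of "Suc j"] unfolding neg_letters_iff
      by (metis Suc_lessD minus_minus)
  next
    case equal
    then have ne: "\<theta> \<noteq> []"
      by auto
    have "\<iota> !! Suc j = shd \<omega>"
      using equal by (simp add: \<iota>_def shift_snth_ge del: snth.simps(2))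
    moreover have "\<iota> !! j = last \<theta>"
      using equal ne by (simp add: \<iota>_def last_conv_nth shift_snth_less flip: equal)
    ultimately have "\<iota> !! Suc j = shd \<omega>" "\<iota> !! j = last \<theta>" "\<theta> \<noteq> []"
      using ne by auto
    \<comment> \<open>If the two letters at the junction cancelled, then \<open>shd \<omega>\<close>
      would be \<open>- last \<theta>\<close>, and \<open>a\<close> would lie in the very image
      removed from \<open>A\<close> in \<open>core\<close>.\<close>
    then show ?thesis
      using a \<omega>(3) by (auto simp: core_def)
  next
    case greater
    then show ?thesis
      using posneg hi[of j] hi[of "Suc j"] by simp
  qed
  have "\<iota> \<in> streams letters"
    unfolding streams_iff_snth using lo hi by (metis UnI1 UnI2 not_le)
  then have hat: "\<iota> \<in> hat_words N"
    unfolding hat_words_def reduced_words_def using reduced lo hi by blast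
  have tail: "code (sdrop j \<iota>) = word (drop j \<theta>) a" if "j \<le> length \<theta>" for j
  proof -
    have "drop j \<theta> \<in> lists letters"
      using \<theta> by (auto dest: in_set_dropD)
    then show ?thesis
      using coding_shift_pos \<omega> that by (simp add: \<iota>_def sdrop_shift)
  qed
  have "entry_time N f A \<iota> = length \<theta>"
    unfolding entry_time_def
  proof (rule Least_equality)
    show "code (sdrop (length \<theta>) \<iota>) \<in> A"
      using tail[of "length \<theta>"] a core_subset by auto
  next
    fix j
    assume j: "code (sdrop j \<iota>) \<in> A"
    show "length \<theta> \<le> j"
    proof (rule ccontr)
      assume "\<not> length \<theta> \<le> j"
      then have "j < length \<theta>"
        by simp
      \<comment> \<open>Every nonempty suffix of \<theta> still ends in
        \<open>last \<theta>\<close>. That letter acts first and pushes \<open>a\<close> out of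
        \<open>A\<close>; \<open>word_neg_notin_A\<close> keeps it outside.\<close>
      then have ne: "\<theta> \<noteq> []" and drop: "drop j \<theta> = butlast (drop j \<theta>) @ [last \<theta>]"
        by (auto, metis append_butlast_last_id drop_eq_Nil2 last_drop not_le)
      have l: "last \<theta> \<in> neg_letters N"
        using \<theta> ne last_in_set by force
      have "letter (last \<theta>) a \<notin> A"
      proof
        assume "letter (last \<theta>) a \<in> A"
        then have "a \<in> letter (- last \<theta>) ` A"
          using letter_cancel(2)[OF l] by (metis image_eqI)
        then show False
          using a ne by (simp add: core_def)
      qed
      moreover have "butlast (drop j \<theta>) \<in> lists (neg_letters N)"
        using \<theta> by (auto dest!: in_set_butlastD in_set_dropD)
      ultimately have "word (drop j \<theta>) a \<notin> A"
        using word_neg_notin_A by (subst drop) (simp add: word_map_append word_map_Cons)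
      then show False
        using j tail[of j] \<open>j < length \<theta>\<close> by simp
    qed
  qed
  then have "address N f A \<iota> = \<theta>"
    by (simp add: address_def \<iota>_def stake_shift)
  with hat tail[of 0] that show thesis
    by simp
qed

section \<open>Images of the attractor under negative words\<close>

abbreviation region :: "int list \<Rightarrow> 'a set" where
  "region \<theta> \<equiv> word \<theta> ` A"

lemma compact_region: "\<theta> \<in> lists (neg_letters N) \<Longrightarrow> compact (region \<theta>)"
  by (intro compact_continuous_image continuous_on_word compact_A neg_words_lists_letters)

lemma region_nonempty: "region \<theta> \<noteq> {}"
  using A_nonempty by simp

lemma A_subset_region:
  assumes "\<theta> \<in> lists (neg_letters N)"
  shows "A \<subseteq> region \<theta>"
  using assms
proof (induction \<theta> rule: lists.induct)
  case (Cons i \<theta>)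
  have "A \<subseteq> letter i ` A"
    using letter_neg_mem_A[OF Cons.hyps(1)] letter_cancel(1)[OF Cons.hyps(1)]
    by (metis image_eqI subsetI)
  also have "\<dots> \<subseteq> region (i # \<theta>)"
    using Cons.IH by (auto simp: word_map_Cons image_comp[symmetric])
  finally show ?case .
qed simp

lemma region_mono:
  assumes "prefix u v" and "v \<in> lists (neg_letters N)"
  shows "region u \<subseteq> region v"
proof -
  obtain w where v: "v = u @ w"
    using assms(1) by (auto simp: prefix_def)
  then have "A \<subseteq> region w"
    using assms(2) by (intro A_subset_region) auto
  then show ?thesis
    by (auto simp: v word_map_append image_comp[symmetric])
qed

text \<open>If \<open>u\<close> were a proper prefix, it would be a prefix of \<theta> without its
  last letter \<open>i\<close>. Cancelling the map of this shorter word puts the \<open>core\<close>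
  point into the image of \<open>A\<close> under \<open>letter (- i)\<close>, which
  \<open>core\<close> excludes.\<close>

lemma word_core_Int_region:
  assumes \<theta>: "\<theta> \<in> lists (neg_letters N)" and u: "prefix u \<theta>"
    and x: "x \<in> word \<theta> ` core \<theta>" "x \<in> region u"
  shows "u = \<theta>"
proof (rule ccontr)
  assume "u \<noteq> \<theta>"
  with u obtain \<eta> i where \<eta>: "\<theta> = \<eta> @ [i]" "prefix u \<eta>"
    by (cases \<theta> rule: rev_cases) auto
  have neg: "\<eta> \<in> lists (neg_letters N)" and i: "i \<in> neg_letters N"
    using \<theta> \<eta>(1) by auto
  obtain c where c: "c \<in> core \<theta>" "x = word \<eta> (letter i c)"
    using x(1) by (auto simp: \<eta>(1) word_map_append word_map_Cons)
  obtain a where a: "a \<in> A" "x = word \<eta> a"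
    using x(2) region_mono[OF \<eta>(2) neg] by auto
  have "letter i c = a"
    using c(2) a(2) inj_word[OF neg_words_lists_letters[OF neg]] by (auto dest: injD)
  then have "c = letter (- i) a"
    using letter_cancel(2)[OF i] by auto
  then show False
    using c(1) a(1) by (auto simp: core_def \<eta>(1))
qed

section \<open>Projections of classes, leaves and panicles\<close>

lemma fmanifoldE:
  assumes "\<alpha> \<in> fmanifold N f A"
  obtains \<iota> where "\<iota> \<in> hat_words N" and "\<alpha> = fm_rel N f A `` {\<iota>}"
    and "fm_proj N f A \<alpha> = code \<iota>" and "fm_address N f A \<alpha> = address N f A \<iota>"
proof -
  obtain \<iota> where \<iota>: "\<iota> \<in> hat_words N" "\<alpha> = fm_rel N f A `` {\<iota>}"
    using assms unfolding fmanifold_def by (auto elim: quotientE)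
  have "code ` \<alpha> = {code \<iota>}" "address N f A ` \<alpha> = {address N f A \<iota>}"
    using \<iota> by (auto simp: fm_rel_def)
  with \<iota> that show thesis
    by (simp add: fm_proj_def fm_address_def)
qed

lemma fmanifoldI:
  assumes "\<iota> \<in> hat_words N"
  obtains \<alpha> where "\<alpha> \<in> fmanifold N f A"
    and "fm_proj N f A \<alpha> = code \<iota>" and "fm_address N f A \<alpha> = address N f A \<iota>"
proof
  show "fm_rel N f A `` {\<iota>} \<in> fmanifold N f A"
    unfolding fmanifold_def using assms by (rule quotientI)
  have "code ` (fm_rel N f A `` {\<iota>}) = {code \<iota>}"
    "address N f A ` (fm_rel N f A `` {\<iota>}) = {address N f A \<iota>}"
    using assms by (auto simp: fm_rel_def)
  then show "fm_proj N f A (fm_rel N f A `` {\<iota>}) = code \<iota>"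
    "fm_address N f A (fm_rel N f A `` {\<iota>}) = address N f A \<iota>"
    by (simp_all add: fm_proj_def fm_address_def)
qed

lemma fmanifold_eqI:
  assumes "\<alpha> \<in> fmanifold N f A" and "\<beta> \<in> fmanifold N f A"
    and "fm_address N f A \<alpha> = fm_address N f A \<beta>" and "fm_proj N f A \<alpha> = fm_proj N f A \<beta>"
  shows "\<alpha> = \<beta>"
proof -
  obtain \<iota> where "\<alpha> = fm_rel N f A `` {\<iota>}"
    "fm_proj N f A \<alpha> = code \<iota>" "fm_address N f A \<alpha> = address N f A \<iota>" "\<iota> \<in> hat_words N"
    using fmanifoldE[OF assms(1)] .
  moreover obtain \<omega> where "\<beta> = fm_rel N f A `` {\<omega>}"
    "fm_proj N f A \<beta> = code \<omega>" "fm_address N f A \<beta> = address N f A \<omega>" "\<omega> \<in> hat_words N"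
    using fmanifoldE[OF assms(2)] .
  ultimately show ?thesis
    using assms(3,4) by (auto simp: fm_rel_def)
qed

lemma fm_address_neg: "\<alpha> \<in> fmanifold N f A \<Longrightarrow> fm_address N f A \<alpha> \<in> lists (neg_letters N)"
  by (metis fmanifoldE address_neg)

lemma fm_proj_mem:
  "\<alpha> \<in> fmanifold N f A
   \<Longrightarrow> fm_proj N f A \<alpha> \<in> word (fm_address N f A \<alpha>) ` core (fm_address N f A \<alpha>)"
  by (metis fmanifoldE coding_mem_core)

lemma fm_proj_mem_region: "\<alpha> \<in> fmanifold N f A \<Longrightarrow> fm_proj N f A \<alpha> \<in> region (fm_address N f A \<alpha>)"
  using fm_proj_mem core_subset by blast

lemma fm_proj_image_leaf:
  assumes "\<theta> \<in> lists (neg_letters N)"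
  shows "fm_proj N f A ` leaf N f A \<theta> = word \<theta> ` core \<theta>"
proof
  show "fm_proj N f A ` leaf N f A \<theta> \<subseteq> word \<theta> ` core \<theta>"
    using fm_proj_mem by (auto simp: leaf_def)
  show "word \<theta> ` core \<theta> \<subseteq> fm_proj N f A ` leaf N f A \<theta>"
  proof
    fix x
    assume "x \<in> word \<theta> ` core \<theta>"
    then obtain \<iota> where \<iota>: "\<iota> \<in> hat_words N" "address N f A \<iota> = \<theta>" "code \<iota> = x"
      using realise_address[OF assms] by blast
    then obtain \<alpha> where "\<alpha> \<in> leaf N f A \<theta>" "fm_proj N f A \<alpha> = x"
      using fmanifoldI[OF \<iota>(1)] by (auto simp: leaf_def)
    then show "x \<in> fm_proj N f A ` leaf N f A \<theta>"
      by blast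
  qed
qed

lemma panicle_mono:
  assumes "prefix \<eta> \<theta>"
  shows "panicle N f A \<eta> \<subseteq> panicle N f A \<theta>"
proof -
  have "take k \<eta> = take k \<theta>" and "k \<le> length \<theta>" if "k \<le> length \<eta>" for k
    using assms that by (auto simp: prefix_def)
  then show ?thesis
    unfolding panicle_def by fastforce
qed

text \<open>One inclusion is monotonicity of regions along prefixes. For the other, appending a
  letter splits the new region into the piece of the new leaf and points already in the old
  region.\<close>

lemma fm_proj_image_panicle:
  assumes "\<theta> \<in> lists (neg_letters N)"
  shows "fm_proj N f A ` panicle N f A \<theta> = region \<theta>"
proof
  show "fm_proj N f A ` panicle N f A \<theta> \<subseteq> region \<theta>"
  proof
    fix x
    assume "x \<in> fm_proj N f A ` panicle N f A \<theta>"
    then obtain k \<kappa> where \<kappa>: "\<kappa> \<in> leaf N f A (take k \<theta>)" "x = fm_proj N f A \<kappa>"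
      unfolding panicle_def by blast
    then have "x \<in> region (take k \<theta>)"
      using fm_proj_mem_region[of \<kappa>] by (simp add: leaf_def)
    then show "x \<in> region \<theta>"
      using region_mono[OF take_is_prefix assms] by blast
  qed
  show "region \<theta> \<subseteq> fm_proj N f A ` panicle N f A \<theta>"
    using assms
  proof (induction \<theta> rule: rev_induct)
    case Nil
    have "region [] = fm_proj N f A ` leaf N f A []"
      using fm_proj_image_leaf[of "[]"] by (simp add: core_def)
    then show ?case
      by (simp add: panicle_def)
  next
    case (snoc i \<theta>)
    have "word (\<theta> @ [i]) a \<in> fm_proj N f A ` panicle N f A (\<theta> @ [i])" if a: "a \<in> A" for a
    proof (cases "a \<in> core (\<theta> @ [i])")
      case True
      then have "word (\<theta> @ [i]) a \<in> fm_proj N f A ` leaf N f A (\<theta> @ [i])"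
        using fm_proj_image_leaf[OF snoc.prems] by blast
      moreover have "leaf N f A (\<theta> @ [i]) \<subseteq> panicle N f A (\<theta> @ [i])"
        unfolding panicle_def by force
      ultimately show ?thesis
        by blast
    next
      case False
      \<comment> \<open>Outside \<open>core\<close>, \<open>a\<close> is the image of some
        \<open>a'\<close> in \<open>A\<close> under \<open>letter (- i)\<close>; the appended letter
        \<open>i\<close> undoes this map, leaving a point of the region of \<theta>.\<close>
      then obtain a' where a': "a' \<in> A" "a = letter (- i) a'"
        using a by (auto simp: core_def)
      then have "word (\<theta> @ [i]) a = word \<theta> a'"
        using snoc.prems by (simp add: word_map_append word_map_Cons)
      also have "\<dots> \<in> fm_proj N f A ` panicle N f A \<theta>"
        using snoc a'(1) by auto
      finally show ?thesis
        using panicle_mono[of \<theta> "\<theta> @ [i]"] by auto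
    qed
    then show ?case
      by blast
  qed
qed

section \<open>The metric of the f-manifold\<close>

abbreviation meet :: "int stream set \<Rightarrow> int stream set \<Rightarrow> int list" where
  "meet \<alpha> \<beta> \<equiv> longest_common_prefix (fm_address N f A \<alpha>) (fm_address N f A \<beta>)"

lemma meet_neg:
  assumes "\<alpha> \<in> fmanifold N f A"
  shows "meet \<alpha> \<beta> \<in> lists (neg_letters N)"
proof -
  have "set (meet \<alpha> \<beta>) \<subseteq> set (fm_address N f A \<alpha>)"
    by (rule set_mono_prefix[OF longest_common_prefix_prefix1])
  then show ?thesis
    using fm_address_neg[OF assms] by (simp add: lists_eq_set)
qed

text \<open>Projecting the panicle turns the infimum over classes into one over a compact set of
  points, where it is attained.\<close>

lemma fm_dist_eq_detour_dist:
  assumes "\<alpha> \<in> fmanifold N f A"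
  shows "fm_dist N f A \<alpha> \<beta> = detour_dist (region (meet \<alpha> \<beta>)) (fm_proj N f A \<alpha>) (fm_proj N f A \<beta>)"
  using fm_proj_image_panicle[OF meet_neg[OF assms, of \<beta>], symmetric]
  unfolding fm_dist_def detour_dist_def by (simp add: image_image)

lemma panicle_nonempty: "panicle N f A \<theta> \<noteq> {}"
proof -
  have "panicle N f A [] \<noteq> {}"
    using fm_proj_image_panicle[of "[]"] A_nonempty by auto
  then show ?thesis
    using panicle_mono[of "[]" \<theta>] by auto
qed

lemma Metric_space_fm_dist: "Metric_space (fmanifold N f A) (fm_dist N f A)"
proof
  fix \<alpha> \<beta>
  \<comment> \<open>\<open>Metric_space\<close> demands nonnegativity and symmetry for all
    arguments, also outside the f-manifold, so both are read off from the definition of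
    \<open>fm_dist\<close>.\<close>
  show "0 \<le> fm_dist N f A \<alpha> \<beta>"
    unfolding fm_dist_def by (rule cINF_greatest[OF panicle_nonempty]) simp
  show "fm_dist N f A \<alpha> \<beta> = fm_dist N f A \<beta> \<alpha>"
    unfolding fm_dist_def by (simp add: longest_common_prefix_commute dist_commute add.commute)
next
  fix \<alpha> \<beta>
  assume \<alpha>: "\<alpha> \<in> fmanifold N f A" and \<beta>: "\<beta> \<in> fmanifold N f A"
  show "fm_dist N f A \<alpha> \<beta> = 0 \<longleftrightarrow> \<alpha> = \<beta>"
  proof
    assume "\<alpha> = \<beta>"
    then show "fm_dist N f A \<alpha> \<beta> = 0"
      using fm_proj_mem_region[OF \<beta>]
      by (simp add: fm_dist_eq_detour_dist[OF \<beta>] longest_common_prefix_self detour_dist_through)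
  next
    assume 0: "fm_dist N f A \<alpha> \<beta> = 0"
    obtain k where k: "k \<in> region (meet \<alpha> \<beta>)"
      "fm_dist N f A \<alpha> \<beta> = dist (fm_proj N f A \<alpha>) k + dist k (fm_proj N f A \<beta>)"
      using detour_dist_attained[OF compact_region[OF meet_neg[OF \<alpha>]] region_nonempty]
      unfolding fm_dist_eq_detour_dist[OF \<alpha>] by metis
    have eq: "fm_proj N f A \<alpha> = k" "fm_proj N f A \<beta> = k"
      using 0 k(2) by (simp_all add: add_nonneg_eq_0_iff)
    \<comment> \<open>The common projection lies in the region of
      \<open>meet \<alpha> \<beta>\<close>, a prefix of both addresses;
      \<open>word_core_Int_region\<close> forces this prefix to be each whole address.\<close>
    have "meet \<alpha> \<beta> = fm_address N f A \<alpha>"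
      using word_core_Int_region[OF fm_address_neg[OF \<alpha>] longest_common_prefix_prefix1
          fm_proj_mem[OF \<alpha>]] eq k(1) by simp
    moreover have "meet \<alpha> \<beta> = fm_address N f A \<beta>"
      using word_core_Int_region[OF fm_address_neg[OF \<beta>] longest_common_prefix_prefix2
          fm_proj_mem[OF \<beta>]] eq k(1) by simp
    ultimately show "\<alpha> = \<beta>"
      using fmanifold_eqI[OF \<alpha> \<beta>] eq by simp
  qed
next
  fix \<alpha> \<beta> \<gamma>
  assume \<alpha>: "\<alpha> \<in> fmanifold N f A" and \<beta>: "\<beta> \<in> fmanifold N f A" and \<gamma>: "\<gamma> \<in> fmanifold N f A"
  note regions = compact_region[OF meet_neg] region_nonempty
  consider "prefix (meet \<alpha> \<beta>) (meet \<alpha> \<gamma>)" | "prefix (meet \<beta> \<gamma>) (meet \<alpha> \<gamma>)"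
    using longest_common_prefix_ultrametric by blast
  then show "fm_dist N f A \<alpha> \<gamma> \<le> fm_dist N f A \<alpha> \<beta> + fm_dist N f A \<beta> \<gamma>"
  proof cases
    case 1
    then show ?thesis
      unfolding fm_dist_eq_detour_dist[OF \<alpha>] fm_dist_eq_detour_dist[OF \<beta>]
      by (intro detour_dist_triangle regions \<alpha> \<beta> region_mono meet_neg)
  next
    case 2
    \<comment> \<open>\<open>detour_dist_triangle\<close> wants its first detour set inside the
      large one, so the route is run backwards from \<gamma> to \<alpha>.\<close>
    then have "detour_dist (region (meet \<alpha> \<gamma>)) (fm_proj N f A \<gamma>) (fm_proj N f A \<alpha>)
        \<le> detour_dist (region (meet \<beta> \<gamma>)) (fm_proj N f A \<gamma>) (fm_proj N f A \<beta>)
          + detour_dist (region (meet \<alpha> \<beta>)) (fm_proj N f A \<beta>) (fm_proj N f A \<alpha>)"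
      by (intro detour_dist_triangle regions \<alpha> \<beta> region_mono meet_neg)
    then show ?thesis
      unfolding fm_dist_eq_detour_dist[OF \<alpha>] fm_dist_eq_detour_dist[OF \<beta>]
      by (simp add: detour_dist_commute)
  qed
qed

section \<open>The topology and number of the leaves\<close>

text \<open>On one leaf the meet is the common address, so the projection of \<alpha> itself is an
  admissible stop and the detour costs nothing.\<close>

lemma fm_dist_leaf:
  assumes "\<alpha> \<in> leaf N f A \<theta>" and "\<beta> \<in> leaf N f A \<theta>"
  shows "fm_dist N f A \<alpha> \<beta> = dist (fm_proj N f A \<alpha>) (fm_proj N f A \<beta>)"
proof -
  have "\<alpha> \<in> fmanifold N f A" and "meet \<alpha> \<beta> = fm_address N f A \<alpha>"
    using assms by (auto simp: leaf_def longest_common_prefix_self)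
  then show ?thesis
    using fm_proj_mem_region by (simp add: fm_dist_eq_detour_dist detour_dist_through)
qed

lemma leaf_homeomorphic_core:
  assumes "\<theta> \<in> lists (neg_letters N)"
  shows "subtopology (fm_topology N f A) (leaf N f A \<theta>) homeomorphic_space top_of_set (core \<theta>)"
proof -
  interpret Metric_space "fmanifold N f A" "fm_dist N f A"
    by (rule Metric_space_fm_dist)
  have "leaf N f A \<theta> \<subseteq> fmanifold N f A"
    by (auto simp: leaf_def)
  then have "subtopology (fm_topology N f A) (leaf N f A \<theta>)
      homeomorphic_space top_of_set (fm_proj N f A ` leaf N f A \<theta>)"
    unfolding fm_topology_def by (rule isometric_subset_homeomorphic) (rule fm_dist_leaf)
  then have "subtopology (fm_topology N f A) (leaf N f A \<theta>)
      homeomorphic_space top_of_set (word \<theta> ` core \<theta>)"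
    by (simp only: fm_proj_image_leaf[OF assms])
  moreover obtain g where "homeomorphism UNIV UNIV (word \<theta>) g"
    using homeomorphism_word neg_words_lists_letters[OF assms] .
  then have "homeomorphism (core \<theta>) (word \<theta> ` core \<theta>) (word \<theta>) g"
    by (rule homeomorphism_of_subsets[where T'' = UNIV]) auto
  then have "top_of_set (word \<theta> ` core \<theta>) homeomorphic_space top_of_set (core \<theta>)"
    using homeomorphism_imp_homeomorphic_space homeomorphic_space_sym by blast
  ultimately show ?thesis
    by (rule homeomorphic_space_trans)
qed

text \<open>Pigeonhole over the possible cores: \<open>A\<close> and one set for each positive
  letter. Finiteness is stated as well because \<open>card\<close> is 0 on infinite sets.\<close>

lemma card_nonhomeomorphic_leaves:
  assumes "\<T> \<subseteq> leaves N f A"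
    and nonhom: "pairwise (\<lambda>l l'. \<not> subtopology (fm_topology N f A) l
                    homeomorphic_space subtopology (fm_topology N f A) l') \<T>"
  shows "finite \<T> \<and> card \<T> \<le> N + 1"
proof -
  define S where "S = insert A ((\<lambda>i. A - letter i ` A) ` pos_letters N)"
  have core_S: "core \<theta> \<in> S" if \<theta>: "\<theta> \<in> lists (neg_letters N)" for \<theta>
  proof (cases "\<theta> = []")
    case False
    then have "- last \<theta> \<in> pos_letters N"
      using \<theta> last_in_set neg_letters_iff by blast
    with False show ?thesis
      by (auto simp: S_def core_def)
  qed (simp add: S_def core_def)
  have "\<exists>C\<in>S. subtopology (fm_topology N f A) l homeomorphic_space top_of_set C" if "l \<in> \<T>" for l
    using that assms(1) core_S leaf_homeomorphic_core unfolding leaves_def by blast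
  then obtain c where c: "\<And>l. l \<in> \<T> \<Longrightarrow> c l \<in> S"
    "\<And>l. l \<in> \<T> \<Longrightarrow> subtopology (fm_topology N f A) l homeomorphic_space top_of_set (c l)"
    by metis
  \<comment> \<open>Leaves with the same model set are homeomorphic to each other, hence equal
    within the family.\<close>
  have "inj_on c \<T>"
  proof
    fix l l'
    assume "l \<in> \<T>" "l' \<in> \<T>" "c l = c l'"
    then have "subtopology (fm_topology N f A) l
        homeomorphic_space subtopology (fm_topology N f A) l'"
      using c(2) homeomorphic_space_trans homeomorphic_space_sym by metis
    then show "l = l'"
      using nonhom \<open>l \<in> \<T>\<close> \<open>l' \<in> \<T>\<close> by (auto simp: pairwise_def)
  qed
  moreover have "finite S"
    by (simp add: S_def pos_letters_def)
  moreover have "c ` \<T> \<subseteq> S"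
    using c(1) by blast
  moreover have "card S \<le> N + 1"
  proof -
    have "card S \<le> Suc (card ((\<lambda>i. A - letter i ` A) ` pos_letters N))"
      unfolding S_def by (rule card_insert_le_m1) (auto simp: pos_letters_def)
    also have "\<dots> \<le> N + 1"
      using card_image_le[of "pos_letters N" "\<lambda>i. A - letter i ` A"] by (simp add: pos_letters_def)
    finally show ?thesis .
  qed
  ultimately show ?thesis
    by (meson card_inj_on_le inj_on_finite order_trans)
qed

end

theorem theorem6p5:
  fixes N :: nat and f :: "nat \<Rightarrow> 'a::complete_space \<Rightarrow> 'a" and A :: "'a set"
  assumes "ifs N f" and "attractor N f A" and "point_fibred N f A"
  shows "(\<forall>\<T> \<subseteq> leaves N f A.
            pairwise (\<lambda>l l'. \<not> subtopology (fm_topology N f A) l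
                               homeomorphic_space subtopology (fm_topology N f A) l') \<T>
            \<longrightarrow> finite \<T> \<and> card \<T> \<le> N + 1)
       \<and> subtopology (fm_topology N f A) (leaf N f A []) homeomorphic_space top_of_set A
       \<and> (\<forall>\<theta> \<in> lists (neg_letters N). \<theta> \<noteq> [] \<longrightarrow>
            subtopology (fm_topology N f A) (leaf N f A \<theta>)
              homeomorphic_space top_of_set (A - letter_map f (- last \<theta>) ` A))"
proof -
  interpret point_fibred_ifs N f A
    by (rule point_fibred_ifs.intro[OF assms])
  have "subtopology (fm_topology N f A) (leaf N f A []) homeomorphic_space top_of_set A"
    using leaf_homeomorphic_core[of "[]"] by (simp add: core_def)
  moreover have "subtopology (fm_topology N f A) (leaf N f A \<theta>)
      homeomorphic_space top_of_set (A - letter_map f (- last \<theta>) ` A)"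
    if "\<theta> \<in> lists (neg_letters N)" and "\<theta> \<noteq> []" for \<theta>
    using leaf_homeomorphic_core[OF that(1)] that(2) unfolding core_def by simp
  ultimately show ?thesis
    using card_nonhomeomorphic_leaves by blast
qed

end
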